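(* Let $l_x,l_y,l_z,u_z$ be real numbers with $0<l_z<u_z<1$, $l_z\le l_x\le u_z$, $l_z\le l_y\le u_z$ and $l_xl_y<l_z$. Suppose that $(l_x,l_y)$ is in region A, i.e. $l_x\ge\sqrt{l_zu_z}$, $l_y\ge\sqrt{l_zu_z}$ and $l_xl_y<l_z$. Let $\mathcal F'=\{(x,y,z)\in\mathbb R^3 : z=xy,\ l_x\le x\le 1,\ l_y\le y\le 1,\ l_z\le z\le u_z\}$. Then $\operatorname{conv}(\mathcal F')$ is exactly the set of $(x,y,z)\in\mathbb R^3$ satisfying the RLT constraints $$z\ge x+y-1,\qquad z\ge l_yx+l_xy-l_xl_y,\qquad z\le x+l_xy-l_x,\qquad z\le l_yx+y-l_y,$$ the bounds $l_z\le z\le u_z$, and the following three second-order cone constraints, each imposed only when $(x,y)$ is in the indicated region: 1. if $y\ge(l_y^2/l_z)x$ and $y\le(l_z/l_x^2)x$, then $(z+\sqrt{l_zu_z})^2\le(\sqrt{l_z}+\sqrt{u_z})^2\,xy$; 2. if $y\le(l_y^2/l_z)x$, then, with $l_x':=l_z/l_y$, $$u_z(z-l_x'l_y)^2\le\big(u_z(x-l_x')+l_x'(z-l_yx)\big)\big(u_z(y-l_y)+l_y(z-l_x'y)\big);$$ 3. if $y\ge(l_z/l_x^2)x$, then, with $l_y':=l_z/l_x$, $$u_z(z-l_xl_y')^2\le\big(u_z(x-l_x)+l_x(z-l_y'x)\big)\big(u_z(y-l_y')+l_y'(z-l_xy)\big).$$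
   Context: $\operatorname{conv}$ denotes the convex hull in $\mathbb R^3$. "RLT" stands for Reformulation-Linearization Technique; the RLT constraints are written out in the claim for the box $l_x\le x\le 1$, $l_y\le y\le 1$. *)

theory Defs
  imports "HOL-Analysis.Analysis"
begin

end

theory Submission
  imports Defs
begin

text \<open>
  Write \<open>a\<close>, \<open>b\<close>, \<open>l\<close>, \<open>u\<close> for \<open>lx\<close>, \<open>ly\<close>, \<open>lz\<close>, \<open>uz\<close>. The inclusion from left to right holds because each second-order cone constraint is an envelope of
  linear inequalities that are valid on the surface \<open>z = x * y\<close>.

  For the converse, fix the level \<open>z\<close>. The slice of the hull contains its extreme corners
  \<open>T = (m, z / m)\<close> and \<open>R = (z / n, n)\<close> with \<open>m = max z a\<close> and \<open>n = max z b\<close>. A point beyond the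
  chord \<open>TR\<close> can occur only if \<open>z\<close> lies strictly between \<open>a\<close> and \<open>b\<close>, and then it is in a triangle whose
  third vertex is on the segment from \<open>(a, 1, a)\<close> to \<open>(1, b, b)\<close>. A point on the near side is
  written as a convex combination of \<open>T\<close>, \<open>R\<close> and a boundary point on its ray from the vertex of the
  conic. In the central region the boundary point is on a segment between the curves \<open>x * y = l\<close> and
  \<open>x * y = u\<close> on a common ray from the origin; in the outer regions it is on a segment from
  the end point of the curve \<open>x * y = l\<close> to the curve \<open>x * y = u\<close>. The part of an outer region that lies
  past the last such segment is a triangle. The third region follows from the second by exchanging
  \<open>x\<close> and \<open>y\<close>.
\<close>

section \<open>Convex combinations at a fixed level; linear inequalities on hulls\<close>

lemma tri_mem:
  fixes C :: "(real \<times> real \<times> real) set"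
  assumes "convex C" "(x1, y1, z) \<in> C" "(x2, y2, z) \<in> C" "(x3, y3, z) \<in> C"
    and "0 \<le> p" "0 \<le> q" "0 \<le> r" "p + q + r = 1"
    and "x = p * x1 + q * x2 + r * x3" "y = p * y1 + q * y2 + r * y3"
  shows "(x, y, z) \<in> C"
proof -
  have "p *\<^sub>R (x1, y1, z) + q *\<^sub>R (x2, y2, z) + r *\<^sub>R (x3, y3, z)
      \<in> convex hull {(x1, y1, z), (x2, y2, z), (x3, y3, z)}"
    unfolding convex_hull_3 using assms by blast
  also have "\<dots> \<subseteq> C" using assms by (intro hull_minimal) auto
  moreover have "p * z + q * z + r * z = z"
    using \<open>p + q + r = 1\<close> by (metis distrib_right mult_1)
  ultimately show ?thesis using assms by auto
qed

text \<open>All points share the level \<open>z\<close>, so this is plane geometry. With O = (ox,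
  oy), the sign conditions place P = (x, y) in the triangle OTR; W is on the segment OP, hence P is
  in the triangle WTR. Cramer's rule expresses P - O as \<open>\<alpha>\<close> times T - O plus
  \<open>\<beta>\<close> times R - O.\<close>

lemma cone_mem:
  fixes C :: "(real \<times> real \<times> real) set"
  assumes "convex C" and s: "1 \<le> s"
    and W: "(ox + (x - ox) / s, oy + (y - oy) / s, z) \<in> C"
    and T: "(tx, ty, z) \<in> C" and R: "(rx, ry, z) \<in> C"
    and D: "0 < (rx - ox) * (ty - oy) - (ry - oy) * (tx - ox)"
    and R_side: "0 \<le> (rx - ox) * (y - oy) - (ry - oy) * (x - ox)"
    and T_side: "0 \<le> (x - ox) * (ty - oy) - (y - oy) * (tx - ox)"
    and chord: "0 \<le> (tx - rx) * (y - ry) - (ty - ry) * (x - rx)"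
  shows "(x, y, z) \<in> C"
proof -
  define D where "D = (rx - ox) * (ty - oy) - (ry - oy) * (tx - ox)"
  define \<alpha> where "\<alpha> = ((rx - ox) * (y - oy) - (ry - oy) * (x - ox)) / D"
  define \<beta> where "\<beta> = ((x - ox) * (ty - oy) - (y - oy) * (tx - ox)) / D"
  have D0: "D > 0" using D by (simp add: D_def)
  have \<alpha>\<beta>: "0 \<le> \<alpha>" "0 \<le> \<beta>" using R_side T_side D0 by (auto simp: \<alpha>_def \<beta>_def)
  have aD: "\<alpha> * D = (rx - ox) * (y - oy) - (ry - oy) * (x - ox)"
    and bD: "\<beta> * D = (x - ox) * (ty - oy) - (y - oy) * (tx - ox)"
    using D0 by (auto simp: \<alpha>_def \<beta>_def)
  have "D - (\<alpha> * D + \<beta> * D) = (tx - rx) * (y - ry) - (ty - ry) * (x - rx)"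
    using aD bD D_def by algebra
  then have "(\<alpha> + \<beta>) * D \<le> 1 * D" using chord by (simp add: algebra_simps)
  then have k1: "\<alpha> + \<beta> \<le> 1" using D0 by (simp only: mult_le_cancel_right_pos)
  have "(\<alpha> * (tx - ox) + \<beta> * (rx - ox)) * D = (x - ox) * D"
    using aD bD unfolding D_def by algebra
  then have px: "\<alpha> * (tx - ox) + \<beta> * (rx - ox) = x - ox" using D0 by simp
  have "(\<alpha> * (ty - oy) + \<beta> * (ry - oy)) * D = (y - oy) * D"
    using aD bD unfolding D_def by algebra
  then have py: "\<alpha> * (ty - oy) + \<beta> * (ry - oy) = y - oy" using D0 by simp
  show ?thesis
  proof (cases "\<alpha> + \<beta> = s")
    \<comment> \<open>Since \<open>\<alpha> + \<beta> \<le> 1 \<le> s\<close>, here W and P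
      coincide; excluding this case keeps the denominator of \<open>w\<close> positive.\<close>
    case True
    then have "s = 1" using k1 s by simp
    then show ?thesis using W by simp
  next
    case False
    define \<kappa> where "\<kappa> = \<alpha> + \<beta>"
    define q where "q = 1 / s"
    have \<kappa>: "\<kappa> < s" "\<kappa> \<le> 1" using False k1 s by (auto simp: \<kappa>_def)
    then have \<kappa>q: "\<kappa> * q < 1" "0 < q" "q \<le> 1" using s by (auto simp: q_def)
    \<comment> \<open>Relative to O, W contributes \<open>w * q\<close> times P - O, so weights
      \<open>\<alpha>\<close> and \<open>\<beta>\<close> times \<open>1 - w * q\<close> for T and R
      reproduce P for every \<open>w\<close>. This value makes the weights sum to 1.\<close>
    define w where "w = (1 - \<kappa>) / (1 - \<kappa> * q)"
    have "0 \<le> w" using \<kappa> \<kappa>q by (simp add: w_def)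
    have "\<kappa> * q \<le> \<kappa>" using \<alpha>\<beta> \<kappa>q by (simp add: \<kappa>_def mult_left_le)
    then have "w \<le> 1" using \<kappa> \<kappa>q by (simp add: w_def)
    then have "w * q \<le> 1" using \<open>0 \<le> w\<close> \<kappa>q by (simp add: mult_le_one)
    have weq: "w * (1 - \<kappa> * q) = 1 - \<kappa>" using \<kappa>q by (simp add: w_def)
    show ?thesis
    proof (rule tri_mem[OF \<open>convex C\<close> W T R, where p = w and q = "\<alpha> * (1 - w * q)" and r = "\<beta> * (1 - w * q)"])
      show "w + \<alpha> * (1 - w * q) + \<beta> * (1 - w * q) = 1"
        using weq unfolding \<kappa>_def by (simp add: algebra_simps)
      then have sum1: "\<alpha> * (1 - w * q) + \<beta> * (1 - w * q) = 1 - w" by simp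
      have "w * (ox + (x - ox) * q) + \<alpha> * (1 - w * q) * tx + \<beta> * (1 - w * q) * rx
          = w * (ox + (x - ox) * q) + (1 - w * q) * (\<alpha> * (tx - ox) + \<beta> * (rx - ox))
            + (\<alpha> * (1 - w * q) + \<beta> * (1 - w * q)) * ox" by (simp add: algebra_simps)
      also have "\<dots> = x" unfolding px sum1 by (simp add: algebra_simps)
      finally show "x = w * (ox + (x - ox) / s) + \<alpha> * (1 - w * q) * tx + \<beta> * (1 - w * q) * rx"
        by (simp add: q_def)
      have "w * (oy + (y - oy) * q) + \<alpha> * (1 - w * q) * ty + \<beta> * (1 - w * q) * ry
          = w * (oy + (y - oy) * q) + (1 - w * q) * (\<alpha> * (ty - oy) + \<beta> * (ry - oy))
            + (\<alpha> * (1 - w * q) + \<beta> * (1 - w * q)) * oy" by (simp add: algebra_simps)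
      also have "\<dots> = y" unfolding py sum1 by (simp add: algebra_simps)
      finally show "y = w * (oy + (y - oy) / s) + \<alpha> * (1 - w * q) * ty + \<beta> * (1 - w * q) * ry"
        by (simp add: q_def)
    qed (use \<open>0 \<le> w\<close> \<open>w * q \<le> 1\<close> \<alpha>\<beta> in auto)
  qed
qed

lemma convex_hull_linear_ge:
  fixes A :: "(real \<times> real \<times> real) set"
  assumes "(x, y, z) \<in> convex hull A"
    and "\<And>x y z. (x, y, z) \<in> A \<Longrightarrow> d \<le> c1 * x + c2 * y + c3 * z"
  shows "d \<le> c1 * x + c2 * y + c3 * z"
proof -
  have "convex hull A \<subseteq> {p. (c1, c2, c3) \<bullet> p \<ge> d}"
    using assms(2) by (intro hull_minimal convex_halfspace_ge) (auto simp: algebra_simps)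
  then show ?thesis using assms(1) by (auto simp: algebra_simps)
qed

section \<open>The truncated surface and the parameters of region A\<close>

definition slab :: "real \<Rightarrow> real \<Rightarrow> real \<Rightarrow> real \<Rightarrow> (real \<times> real \<times> real) set" where
  "slab a b l u = {(x, y, z). z = x * y \<and> a \<le> x \<and> x \<le> 1 \<and> b \<le> y \<and> y \<le> 1 \<and> l \<le> z \<and> z \<le> u}"

text \<open>Exchanging the first two coordinates is linear and so commutes with taking the hull.
  This transfers every one-sided argument to its mirror image.\<close>

lemma slab_swap:
  assumes "(x, y, z) \<in> convex hull slab a b l u"
  shows "(y, x, z) \<in> convex hull slab b a l u"
proof -
  define f :: "real \<times> real \<times> real \<Rightarrow> real \<times> real \<times> real" where "f = (\<lambda>(x, y, z). (y, x, z))"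
  have "linear f" by (rule linearI) (auto simp: f_def)
  moreover have "f ` slab a b l u \<subseteq> slab b a l u" by (auto simp: f_def slab_def)
  ultimately have "f ` (convex hull slab a b l u) \<subseteq> convex hull slab b a l u"
    by (metis convex_hull_linear_image hull_mono)
  then have "f (x, y, z) \<in> convex hull slab b a l u" using assms by blast
  then show ?thesis by (simp add: f_def)
qed

text \<open>The bounds by \<open>sqrt (l * u)\<close> are kept in squared form, and the assumptions
  are symmetric in \<open>a\<close> and \<open>b\<close>, so that \<open>swap\<close> gives a second
  instance for mirrored arguments.\<close>

locale region_A =
  fixes a b l u :: real
  assumes l_pos: "0 < l" and l_less_u: "l < u" and u_less_1: "u < 1"
    and a_pos: "0 < a" and b_pos: "0 < b" and a_le_u: "a \<le> u" and b_le_u: "b \<le> u"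
    and ab_less: "a * b < l" and lu_le_a2: "l * u \<le> a\<^sup>2" and lu_le_b2: "l * u \<le> b\<^sup>2"
begin

lemma swap: "region_A b a l u"
  using l_pos l_less_u u_less_1 a_pos b_pos a_le_u b_le_u ab_less lu_le_a2 lu_le_b2
  by unfold_locales (auto simp: mult.commute)

lemma l_less_b: "l < b"
proof -
  have "l\<^sup>2 < b\<^sup>2"
    using mult_strict_left_mono[OF l_less_u l_pos] lu_le_b2 by (simp add: power2_eq_square)
  then show ?thesis using b_pos by (simp add: power2_less_imp_less)
qed

text \<open>Equivalent to b^2 / l < l / a^2: of the two rays bounding the central region, the lower
  one has the strictly smaller slope.\<close>

lemma slope_less: "a\<^sup>2 * b\<^sup>2 < l\<^sup>2"
proof -
  have "(a * b)\<^sup>2 < l\<^sup>2" using ab_less a_pos b_pos l_pos by (intro power_strict_mono) auto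
  then show ?thesis by (simp add: power_mult_distrib)
qed

section \<open>Corners of a level slice and points beyond their chord\<close>

lemma slab_point:
  assumes "0 < g" "0 < k" "a \<le> g * k" "g * k \<le> 1" "b \<le> g / k" "g / k \<le> 1" "l \<le> z" "z \<le> u" "z = g\<^sup>2"
  shows "(g * k, g / k, z) \<in> convex hull slab a b l u"
  using assms by (intro hull_inc) (auto simp: slab_def power2_eq_square)

text \<open>With m = max z a and n = max z b, the inequality l * m^2 \<le> z * a^2 puts the corner T
  = (m, z / m) on or above the ray y = (l / a^2) * x, and m * n < z puts T strictly above and to the
  left of R = (z / n, n).\<close>

lemma corner_bounds:
  assumes "l \<le> z" "z \<le> u"
  shows "0 < max z a" "max z a \<le> u" "a \<le> max z a" "z \<le> max z a" "l * (max z a)\<^sup>2 \<le> z * a\<^sup>2"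
    "max z a * max z b < z"
proof -
  have z0: "0 < z" using assms l_pos by simp
  show "0 < max z a" "max z a \<le> u" "a \<le> max z a" "z \<le> max z a"
    using a_pos a_le_u assms by auto
  have "l * z \<le> a\<^sup>2" using mult_left_mono[OF assms(2), of l] l_pos lu_le_a2 by linarith
  then have "l * z * z \<le> a\<^sup>2 * z" using z0 by (intro mult_right_mono) auto
  moreover have "l * a\<^sup>2 \<le> z * a\<^sup>2" using assms by (intro mult_right_mono) auto
  ultimately show "l * (max z a)\<^sup>2 \<le> z * a\<^sup>2"
    by (auto simp: max_def power2_eq_square algebra_simps)
  have "z * z < z * 1" "a * z < 1 * z" "z * b < z * 1"
    using z0 assms u_less_1 a_le_u b_le_u by (auto simp del: mult_1 mult_1_right intro!: mult_strict_right_mono mult_strict_left_mono)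
  then show "max z a * max z b < z"
    using ab_less assms by (auto simp: max_def)
qed

lemma corner_mem:
  assumes "l \<le> z" "z \<le> u"
  shows "(max z a, z / max z a, z) \<in> convex hull slab a b l u"
proof (rule hull_inc)
  note c = corner_bounds[OF assms]
  have "b * max z a \<le> max z b * max z a" using c(1) by (intro mult_right_mono) auto
  then have "b * max z a \<le> z" using c(6) by (simp only: mult.commute)
  then have "b \<le> z / max z a" using c(1) by (simp add: pos_le_divide_eq)
  then show "(max z a, z / max z a, z) \<in> slab a b l u"
    using c assms u_less_1 by (auto simp: slab_def)
qed

lemma corner_mem':
  assumes "l \<le> z" "z \<le> u"
  shows "(z / max z b, max z b, z) \<in> convex hull slab a b l u"
  using slab_swap[OF region_A.corner_mem[OF swap assms]] .

text \<open>The point \<open>(mx, my)\<close> is the level-\<open>z\<close> point of the segment from \<open>(a, 1, a)\<close> to \<open>(1, b, b)\<close>.\<close>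
lemma above_chord_aux:
  assumes z: "l \<le> z" "z \<le> u" "b < z" "z < a"
    and upper: "z \<ge> x + y - 1" "z \<ge> b * x + a * y - a * b"
    and above: "(a - 1) * (y - z) - (z / a - z) * (x - 1) \<le> 0"
  shows "(x, y, z) \<in> convex hull slab a b l u"
proof -
  let ?H = "convex hull slab a b l u"
  define \<mu> where "\<mu> = (a - z) / (a - b)"
  have \<mu>: "0 \<le> \<mu>" "\<mu> \<le> 1" and \<mu>z: "\<mu> * (a - b) = a - z" using z by (auto simp: \<mu>_def)
  define mx where "mx = (1 - \<mu>) * a + \<mu>"
  define my where "my = (1 - \<mu>) + \<mu> * b"
  have a1: "a < 1" using a_le_u u_less_1 by simp
  have ends: "(a, 1, a) \<in> slab a b l u" "(1, b, b) \<in> slab a b l u"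
    using z a1 a_le_u b_le_u u_less_1 l_less_b by (auto simp: slab_def)
  have "(1 - \<mu>) *\<^sub>R (a, 1, a) + \<mu> *\<^sub>R (1, b, b) \<in> ?H"
    using \<mu> by (intro convexD[OF convex_convex_hull] hull_inc ends) auto
  moreover have zz: "(1 - \<mu>) * a + \<mu> * b = z" using \<mu>z by (simp add: algebra_simps)
  ultimately have M: "(mx, my, z) \<in> ?H" by (simp add: mx_def my_def)
  have T: "(a, z / a, z) \<in> ?H" using corner_mem[OF z(1,2)] z by (simp add: max_def)
  have R: "(1, z, z) \<in> ?H" using corner_mem'[OF z(1,2)] z l_pos by (simp add: max_def split: if_splits)
  \<comment> \<open>Barycentric coordinates for T and R. The slack of z \<ge> x + y - 1 vanishes at
    M and R, that of z \<ge> b * x + a * y - a * b at M and T; each is divided by its value at the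
    remaining vertex.\<close>
  define t where "t = (1 + z - x - y) * a / ((1 - a) * (a - z))"
  define r where "r = (z + a * b - b * x - a * y) / ((1 - a) * (z - b))"
  have pos: "(1 - a) * (a - z) > 0" "(1 - a) * (z - b) > 0" using a1 z by auto
  have tr: "0 \<le> t" "0 \<le> r" using pos upper a_pos by (auto simp: t_def r_def)
  have t: "t * ((1 - a) * (a - z)) = (1 + z - x - y) * a"
    and r: "r * ((1 - a) * (z - b)) = z + a * b - b * x - a * y" using pos by (auto simp: t_def r_def)
  define T2 where "T2 = z / a"
  have T2: "T2 * a = z" using a_pos by (simp add: T2_def)
  have sums: "mx + my = 1 + z" "b * mx + a * my = z + a * b"
    using zz by (auto simp: mx_def my_def algebra_simps)
  define w where "w = 1 - t - r"
  have t': "t * (1 + z - a - T2) = 1 + z - x - y"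
  proof -
    have "a * (t * (1 + z - a - T2)) = a * (1 + z - x - y)" using t T2 by algebra
    then show ?thesis using a_pos by simp
  qed
  have r': "r * (z + a * b - b - a * z) = z + a * b - b * x - a * y"
    using r by (simp add: algebra_simps)
  \<comment> \<open>The errors of the barycentric representation satisfy two linear equations,
    independent because \<open>b < a\<close>.\<close>
  define ex where "ex = w * mx + t * a + r * 1 - x"
  define ey where "ey = w * my + t * T2 + r * z - y"
  have e1: "ex + ey = 0" using t' sums unfolding ex_def ey_def w_def by algebra
  have e2: "b * ex + a * ey = 0" using r' sums T2 unfolding ex_def ey_def w_def by algebra
  have "(a - b) * ex = 0" using e1 e2 by algebra
  then have ex: "ex = 0" using z by simp
  then have ey: "ey = 0" using e1 by simp
  have above': "(a - 1) * (y - z) - (T2 - z) * (x - 1) \<le> 0" using above by (simp add: T2_def)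
  \<comment> \<open>The chord form vanishes at T and R, so only the term with M survives; the form
    is negative at M, which forces \<open>0 \<le> w\<close>.\<close>
  have "(a - 1) * (y - z) - (T2 - z) * (x - 1)
      = w * ((a - 1) * (my - z) - (T2 - z) * (mx - 1))"
    using ex ey T2 unfolding ex_def ey_def w_def by algebra
  moreover have "(a - 1) * (my - z) - (T2 - z) * (mx - 1) < 0"
  proof -
    have d: "my - z = (1 - \<mu>) * (1 - a)" "mx - 1 = - ((1 - \<mu>) * (1 - a))"
      using zz by (auto simp: mx_def my_def algebra_simps)
    then have "(a - 1) * (my - z) - (T2 - z) * (mx - 1) = (1 - \<mu>) * (1 - a) * (a - 1 + T2 - z)"
      using d by algebra
    moreover have "1 - \<mu> > 0" using z by (simp add: \<mu>_def)
    moreover have "a - 1 + T2 - z < 0"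
    proof -
      have "a * (a - 1 + T2 - z) = - ((1 - a) * (a - z))" using T2 by (simp add: algebra_simps)
      then have "a * (a - 1 + T2 - z) < 0" using pos by simp
      then show ?thesis using a_pos by (simp add: mult_less_0_iff)
    qed
    ultimately show ?thesis using a1 by (simp add: mult_pos_neg)
  qed
  ultimately have w0: "0 \<le> w" using above' by (smt (verit) mult_neg_neg)
  show ?thesis
    by (rule tri_mem[OF convex_convex_hull M T R w0 tr])
       (use ex ey in \<open>auto simp: w_def ex_def ey_def T2_def\<close>)
qed

text \<open>If \<open>z\<close> is at least both \<open>a\<close> and \<open>b\<close>, or at most
  both, the chord TR is on the boundary line of one of the two assumed RLT constraints, so no point
  lies beyond it. Only the two mixed cases need the triangle, and they mirror each other.\<close>

lemma above_chord:
  assumes z: "l \<le> z" "z \<le> u"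
    and upper: "z \<ge> x + y - 1" "z \<ge> b * x + a * y - a * b"
    and above: "(max z a - z / max z b) * (y - max z b) - (z / max z a - max z b) * (x - z / max z b) < 0"
  shows "(x, y, z) \<in> convex hull slab a b l u"
proof -
  have z0: "0 < z" "z < 1" using z l_pos u_less_1 by auto
  consider "a \<le> z" "b \<le> z" | "z \<le> a" "z \<le> b" | "b < z" "z < a" | "a < z" "z < b" by linarith
  then show ?thesis
  proof cases
    case 1
    then have "(z - 1) * (y - z) - (1 - z) * (x - 1) < 0" using above z0 by (simp add: max_def)
    moreover have "(1 - z) * (1 + z - x - y) \<ge> 0" using upper z0 by simp
    ultimately have False by (simp add: algebra_simps)
    then show ?thesis ..
  next
    case 2
    then have "(a - z / b) * (y - b) - (z / a - b) * (x - z / b) < 0"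
      using above by (cases "z = a"; cases "z = b") (auto simp: max_def)
    moreover have "(a - z / b) * (y - b) - (z / a - b) * (x - z / b)
        = (z - a * b) * (z + a * b - a * y - b * x) / (a * b)"
      using a_pos b_pos by (simp add: field_simps)
    moreover have "(z - a * b) * (z + a * b - a * y - b * x) / (a * b) \<ge> 0"
      using upper a_pos b_pos ab_less z by (intro divide_nonneg_pos mult_nonneg_nonneg) auto
    ultimately show ?thesis by linarith
  next
    case 3
    then have "(a - 1) * (y - z) - (z / a - z) * (x - 1) \<le> 0" using above z0 by (simp add: max_def)
    with 3 z upper show ?thesis by (intro above_chord_aux)
  next
    case 4
    define Z where "Z = z / b"
    from 4 above z0 have "(z - Z) * (y - b) - (1 - b) * (x - Z) \<le> 0" by (simp add: max_def Z_def)
    then have "(b - 1) * (x - z) - (Z - z) * (y - 1) \<le> 0" by (simp add: algebra_simps)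
    then have "(y, x, z) \<in> convex hull slab b a l u"
      using 4 z upper by (intro region_A.above_chord_aux[OF swap]) (auto simp: algebra_simps Z_def)
    then show ?thesis by (rule slab_swap)
  qed
qed

text \<open>The determinant of R and T as vectors from the origin, which is the apex for the central
  region.\<close>

lemma corners_positively_oriented:
  assumes "l \<le> z" "z \<le> u"
  shows "0 < (z / max z b) * (z / max z a) - max z b * max z a"
proof -
  note c = corner_bounds[OF assms]
  note c' = region_A.corner_bounds[OF swap assms]
  have "(max z a * max z b) * (max z a * max z b) < z * z"
    using c(1,6) c'(1) assms l_pos by (intro mult_strict_mono) auto
  then show ?thesis using c(1) c'(1) by (simp add: field_simps)
qed

section \<open>Sufficiency of the constraints over the central region\<close>

text \<open>On the ray through (x, y) = (g * k, g / k), the segment from the curve x * y = l to the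
  curve x * y = u meets level \<open>z\<close> at (w * k, w / k). The second-order cone constraint
  says exactly \<open>w \<le> g\<close>, so \<open>cone_mem\<close> applies with the origin as
  apex.\<close>

lemma cone1_region:
  assumes z: "l \<le> z" "z \<le> u"
    and reg: "b\<^sup>2 / l * x \<le> y" "y \<le> l / a\<^sup>2 * x"
    and soc: "(z + sqrt (l * u))\<^sup>2 \<le> (sqrt l + sqrt u)\<^sup>2 * (x * y)"
    and upper: "z \<ge> x + y - 1" "z \<ge> b * x + a * y - a * b"
  shows "(x, y, z) \<in> convex hull slab a b l u"
proof (cases "(max z a - z / max z b) * (y - max z b) - (z / max z a - max z b) * (x - z / max z b) < 0")
  case True
  then show ?thesis using above_chord assms by blast
next
  case False
  let ?H = "convex hull slab a b l u"
  have u_pos: "0 < u" using l_pos l_less_u by simp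
  have reg': "b\<^sup>2 * x \<le> l * y" "a\<^sup>2 * y \<le> l * x" using reg l_pos a_pos by (auto simp: field_simps)
  define sl where "sl = sqrt l"
  define su where "su = sqrt u"
  have sl: "0 < sl" "sl\<^sup>2 = l" and su: "0 < su" "su\<^sup>2 = u" and slsu: "sqrt (l * u) = sl * su"
    using l_pos u_pos by (auto simp: sl_def su_def real_sqrt_mult)
  have "sl \<le> su" using l_less_u by (simp add: sl_def su_def)
  have "0 < z + sl * su" using z l_pos sl su by (simp add: add_pos_pos)
  then have "0 < (z + sl * su)\<^sup>2" by simp
  moreover have soc': "(z + sl * su)\<^sup>2 \<le> (sl + su)\<^sup>2 * (x * y)"
    using soc unfolding slsu by (simp add: sl_def su_def)
  ultimately have "0 < (sl + su)\<^sup>2 * (x * y)" by linarith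
  then have xy: "0 < x * y" by (simp add: zero_less_mult_iff)
  \<comment> \<open>The constraint only gives x * y > 0. Two negative coordinates would contradict
    the ray inequalities because b^2 / l < l / a^2.\<close>
  have "0 < x"
  proof (rule ccontr)
    assume "\<not> 0 < x"
    then have neg: "x < 0" "y < 0" using xy by (auto simp: zero_less_mult_iff)
    have "l * (b\<^sup>2 * x) \<le> l * (l * y)" "b\<^sup>2 * (a\<^sup>2 * y) \<le> b\<^sup>2 * (l * x)"
      using reg' l_pos by (auto intro: mult_left_mono)
    then have "(a\<^sup>2 * b\<^sup>2) * y \<le> l\<^sup>2 * y" by (simp add: power2_eq_square algebra_simps)
    moreover have "l\<^sup>2 * y < (a\<^sup>2 * b\<^sup>2) * y" using slope_less neg by (simp add: mult_strict_right_mono_neg)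
    ultimately show False by simp
  qed
  then have "0 < y" using xy by (simp add: zero_less_mult_iff)
  define g where "g = sqrt (x * y)"
  define k where "k = sqrt (x / y)"
  have g0: "0 < g" and k0: "0 < k" using \<open>0 < x\<close> \<open>0 < y\<close> by (auto simp: g_def k_def)
  have k2: "k\<^sup>2 = x / y" using \<open>0 < x\<close> \<open>0 < y\<close> by (simp add: k_def)
  have xg: "x = g * k" and yg: "y = g / k"
    using \<open>0 < x\<close> \<open>0 < y\<close> by (simp_all add: g_def k_def real_sqrt_mult[symmetric] real_sqrt_divide[symmetric] field_simps)
  define w where "w = (z + sl * su) / (sl + su)"
  have w0: "0 < w" using sl su z l_pos by (simp add: w_def add_pos_pos)
  have ww: "w * (sl + su) = z + sl * su" using sl su by (simp add: w_def)
  have "(w * (sl + su))\<^sup>2 \<le> ((sl + su) * g)\<^sup>2"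
    using soc' xy unfolding ww by (simp add: power_mult_distrib g_def)
  then have "w * (sl + su) \<le> (sl + su) * g" by (rule power2_le_imp_le) (use sl su g0 in auto)
  then have wg: "w \<le> g" using sl su by (simp add: mult.commute)
  \<comment> \<open>The bounding rays keep the coordinates of the lower end point at least
    \<open>a\<close> and \<open>b\<close>; the bounds on \<open>l * u\<close> used below keep those
    of the upper end point at most 1.\<close>
  have kl: "a\<^sup>2 \<le> l * k\<^sup>2" "b\<^sup>2 * k\<^sup>2 \<le> l" using reg' \<open>0 < y\<close> unfolding k2 by (auto simp: field_simps)
  have k_low: "a \<le> sl * k" by (rule power2_le_imp_le) (use kl sl k0 in \<open>auto simp: power_mult_distrib\<close>)
  have "(b * k)\<^sup>2 \<le> sl\<^sup>2" using kl sl by (simp add: power_mult_distrib)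
  then have "b * k \<le> sl" by (rule power2_le_imp_le) (use sl in auto)
  then have k_low': "b \<le> sl / k" using k0 by (simp add: field_simps)
  have "(l * u) * k\<^sup>2 \<le> b\<^sup>2 * k\<^sup>2" using lu_le_b2 by (intro mult_right_mono) auto
  then have "l * (u * k\<^sup>2) \<le> l * 1" using kl by simp
  then have "u * k\<^sup>2 \<le> 1" using l_pos by (simp only: mult_le_cancel_left_pos)
  then have "(su * k)\<^sup>2 \<le> 1\<^sup>2" using su by (simp add: power_mult_distrib)
  then have k_up: "su * k \<le> 1" by (rule power2_le_imp_le) simp
  have "l * u \<le> l * k\<^sup>2" using lu_le_a2 kl by simp
  then have "u \<le> k\<^sup>2" using l_pos by (simp only: mult_le_cancel_left_pos)
  then have "su\<^sup>2 \<le> k\<^sup>2" using su by simp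
  then have "su \<le> k" by (rule power2_le_imp_le) (use k0 in auto)
  then have k_up': "su / k \<le> 1" using k0 by simp
  have mono: "sl * k \<le> su * k" "sl / k \<le> su / k"
    using \<open>sl \<le> su\<close> k0 by (auto intro: mult_right_mono divide_right_mono)
  have ranges: "sl * k \<le> 1" "sl / k \<le> 1" "a \<le> su * k" "b \<le> su / k"
    using mono k_low k_low' k_up k_up' by linarith+
  have L: "(sl * k, sl / k, l) \<in> ?H"
    by (rule slab_point[OF sl(1) k0 k_low ranges(1) k_low' ranges(2)]) (use sl l_less_u in auto)
  have U: "(su * k, su / k, u) \<in> ?H"
    by (rule slab_point[OF su(1) k0 ranges(3) k_up ranges(4) k_up']) (use su l_less_u in auto)
  define \<nu> where "\<nu> = (z - l) / (u - l)"
  have \<nu>: "0 \<le> \<nu>" "\<nu> \<le> 1" and \<nu>z: "\<nu> * (u - l) = z - l" using z l_less_u by (auto simp: \<nu>_def)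
  have zl: "(1 - \<nu>) * l + \<nu> * u = z" using \<nu>z by (simp add: algebra_simps)
  \<comment> \<open>The level and the factor of (k, 1 / k) are both affine in \<open>\<nu>\<close>;
    eliminating \<open>\<nu>\<close> gives the definition of \<open>w\<close>.\<close>
  have "((1 - \<nu>) * sl + \<nu> * su) * (sl + su) = w * (sl + su)"
    unfolding ww zl[symmetric] sl(2)[symmetric] su(2)[symmetric] by (simp add: power2_eq_square algebra_simps)
  then have wl: "(1 - \<nu>) * sl + \<nu> * su = w" using sl su by simp
  have "(1 - \<nu>) *\<^sub>R (sl * k, sl / k, l) + \<nu> *\<^sub>R (su * k, su / k, u) \<in> ?H"
    using \<nu> by (intro convexD[OF convex_convex_hull] L U) auto
  moreover have "(1 - \<nu>) * (sl * k) + \<nu> * (su * k) = w * k" "(1 - \<nu>) * (sl / k) + \<nu> * (su / k) = w / k"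
    unfolding wl[symmetric] by (auto simp: algebra_simps add_divide_distrib diff_divide_distrib)
  ultimately have W: "(w * k, w / k, z) \<in> ?H" using zl by simp
  note c = corner_bounds[OF z]
  note c' = region_A.corner_bounds[OF swap z]
  \<comment> \<open>R is on or below the lower bounding ray and T on or above the upper one, so (x,
    y) lies in the cone spanned by R and T.\<close>
  have bx: "max z b * max z b * x \<le> z * y"
  proof -
    have "l * (max z b)\<^sup>2 * x \<le> z * b\<^sup>2 * x" using c'(5) \<open>0 < x\<close> by (intro mult_right_mono) auto
    also have "\<dots> \<le> z * (l * y)" using reg' z l_pos by (simp add: mult.assoc)
    finally have "l * ((max z b)\<^sup>2 * x) \<le> l * (z * y)" by (simp add: algebra_simps)
    then show ?thesis using l_pos by (simp add: power2_eq_square)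
  qed
  have ay: "max z a * max z a * y \<le> z * x"
  proof -
    have "l * (max z a)\<^sup>2 * y \<le> z * a\<^sup>2 * y" using c(5) \<open>0 < y\<close> by (intro mult_right_mono) auto
    also have "\<dots> \<le> z * (l * x)" using reg' z l_pos by (simp add: mult.assoc)
    finally have "l * ((max z a)\<^sup>2 * y) \<le> l * (z * x)" by (simp add: algebra_simps)
    then show ?thesis using l_pos by (simp add: power2_eq_square)
  qed
  show ?thesis
  proof (rule cone_mem[OF convex_convex_hull _ _ corner_mem[OF z] corner_mem'[OF z], where s = "g / w" and ox = 0 and oy = 0])
    show "1 \<le> g / w" using wg w0 by simp
    show "(0 + (x - 0) / (g / w), 0 + (y - 0) / (g / w), z) \<in> ?H"
      using W g0 w0 by (simp add: xg yg mult.commute)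
    show "0 < (z / max z b - 0) * (z / max z a - 0) - (max z b - 0) * (max z a - 0)"
      using corners_positively_oriented[OF z] by simp
    show "0 \<le> (z / max z b - 0) * (y - 0) - (max z b - 0) * (x - 0)"
      using bx c'(1) by (simp add: field_simps)
    show "0 \<le> (x - 0) * (z / max z a - 0) - (y - 0) * (max z a - 0)"
      using ay c(1) by (simp add: field_simps)
  qed (use False in simp)
qed

section \<open>Sufficiency of the constraints over an outer region\<close>

text \<open>Offsets from the apex (1 - \<nu>) * (l / b, b), where \<nu> = (z - l) / (u - l), are
  scaled by u - l to X = (u - l) * x - (l / b) * (u - z) and Y = (u - l) * y - b * (u - z). In these
  coordinates R is on or below the ray Y = u * X, which belongs to the last segment, ending at (1,
  u, u); T is strictly above the line l * Y = b^2 * X bounding the region.\<close>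

lemma cone2_corners:
  assumes "l \<le> z" "z \<le> u"
  shows "z - l \<le> (u - l) * (z / max z b) - l / b * (u - z)"
    and "(u - l) * max z b - b * (u - z) \<le> u * ((u - l) * (z / max z b) - l / b * (u - z))"
    and "b * (z - l) \<le> (u - l) * (z / max z a) - b * (u - z)"
    and "b\<^sup>2 * ((u - l) * max z a - l / b * (u - z)) < l * ((u - l) * (z / max z a) - b * (u - z))"
proof -
  have z0: "0 < z" and u0: "0 < u" using assms l_pos by auto
  note c = corner_bounds[OF assms]
  have *: "z - l \<le> (u - l) * (z / max z b) - l / b * (u - z) \<and>
    (u - l) * max z b - b * (u - z) \<le> u * ((u - l) * (z / max z b) - l / b * (u - z))"
  proof (cases "z \<le> b")
    case True
    then have m: "max z b = b" by simp
    have e: "(u - l) * (z / b) - l / b * (u - z) = u * (z - l) / b"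
      "(u - l) * b - b * (u - z) = b * (z - l)"
      using b_pos by (auto simp: field_simps)
    have "b * b \<le> u * u" using b_pos b_le_u by (intro mult_mono) auto
    then have "b * b * (z - l) \<le> u * u * (z - l)" using assms by (intro mult_right_mono) auto
    then have "b * (z - l) \<le> u * (u * (z - l) / b)" using b_pos by (simp add: field_simps)
    moreover have "b * (z - l) \<le> u * (z - l)" using b_le_u assms by (intro mult_right_mono) auto
    then have "z - l \<le> u * (z - l) / b" using b_pos by (simp add: field_simps)
    ultimately show ?thesis unfolding m e by simp
  next
    case False
    then have m: "max z b = z" by simp
    define x' where "x' = l / b"
    have x': "0 < x'" "x' < 1" using l_pos b_pos l_less_b by (auto simp: x'_def)
    have "l * u \<le> b * b" using lu_le_b2 by (simp add: power2_eq_square)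
    then have ux: "u * x' \<le> b" using b_pos by (simp add: x'_def field_simps)
    have "x' * (u - z) \<le> 1 * (u - z)" using x' assms by (intro mult_right_mono) auto
    then have "z - l \<le> (u - l) - x' * (u - z)" using assms by simp
    moreover have "0 \<le> (u - z) * ((u - l) + (b - u * x'))"
      using ux l_less_u assms by (intro mult_nonneg_nonneg) auto
    then have "(u - l) * z - b * (u - z) \<le> u * ((u - l) - x' * (u - z))"
      by (simp add: algebra_simps)
    ultimately show ?thesis unfolding m using z0 by (simp add: x'_def)
  qed
  then show "z - l \<le> (u - l) * (z / max z b) - l / b * (u - z)"
    "(u - l) * max z b - b * (u - z) \<le> u * ((u - l) * (z / max z b) - l / b * (u - z))" by auto
  have "b * max z a \<le> max z b * max z a" using c(1) by (intro mult_right_mono) auto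
  then have "b * max z a \<le> z" using c(6) by (simp only: mult.commute)
  then have "b \<le> z / max z a" using c(1) by (simp add: pos_le_divide_eq)
  then have "(u - l) * b \<le> (u - l) * (z / max z a)" using l_less_u by (intro mult_left_mono) auto
  then show "b * (z - l) \<le> (u - l) * (z / max z a) - b * (u - z)" by (simp add: algebra_simps)
  have "l * (l * (b\<^sup>2 * (max z a)\<^sup>2)) = b\<^sup>2 * l * (l * (max z a)\<^sup>2)" by (simp add: algebra_simps)
  also have "\<dots> \<le> b\<^sup>2 * l * (z * a\<^sup>2)" using c(5) l_pos by (intro mult_left_mono) auto
  also have "\<dots> = (l * z) * (a\<^sup>2 * b\<^sup>2)" by (simp add: algebra_simps)
  also have "\<dots> < (l * z) * l\<^sup>2" using slope_less l_pos z0 by (intro mult_strict_left_mono) auto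
  also have "\<dots> = l * (l * (l * z))" by (simp add: power2_eq_square algebra_simps)
  finally have "b\<^sup>2 * (max z a)\<^sup>2 < l * z" using l_pos by (simp only: mult_less_cancel_left_pos)
  then have "b\<^sup>2 * max z a < l * (z / max z a)" using c(1) by (simp add: field_simps power2_eq_square)
  then have "(u - l) * (b\<^sup>2 * max z a) < (u - l) * (l * (z / max z a))"
    using l_less_u by (intro mult_strict_left_mono) auto
  moreover have "b\<^sup>2 * (l / b * (u - z)) = l * (b * (u - z))"
    using b_pos by (simp add: power2_eq_square)
  ultimately show "b\<^sup>2 * ((u - l) * max z a - l / b * (u - z)) < l * ((u - l) * (z / max z a) - b * (u - z))"
    unfolding right_diff_distrib by (simp add: mult.left_commute)
qed

text \<open>At level \<open>l\<close> the apex is (l / b, b) itself and the cone argument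
  degenerates. The linear constraints force y \<ge> b and then b * x \<le> l, which the region
  condition turns into y \<le> b.\<close>

lemma cone2_base_region:
  assumes reg: "y \<le> b\<^sup>2 / l * x" and upper: "l \<ge> b * x + a * y - a * b" and line: "l \<le> b * x + y - b"
  shows "x = l / b \<and> y = b"
proof -
  define dx where "dx = x - l / b"
  have bx: "b * x = b * dx + l" using b_pos by (simp add: dx_def algebra_simps)
  have reg': "l * y \<le> b * (b * x)" using reg l_pos by (simp add: field_simps power2_eq_square)
  have a1: "a < 1" using a_le_u u_less_1 by simp
  have "0 \<le> (1 - a) * (y - b)" using upper line bx by (simp add: algebra_simps)
  then have y1: "b \<le> y" using a1 by (simp add: zero_le_mult_iff)
  have "b * dx \<le> - (a * (y - b))" using upper bx by (simp add: algebra_simps)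
  also have "\<dots> \<le> 0" using y1 a_pos by simp
  finally have "b * (b * dx) \<le> 0" using b_pos by (simp add: mult_le_0_iff)
  moreover have "l * (y - b) \<le> b * (b * dx)" using reg' bx by (simp add: algebra_simps)
  ultimately have "l * (y - b) \<le> 0" by simp
  then have "y \<le> b" using l_pos by (simp add: mult_le_0_iff)
  then have y: "y = b" using y1 by simp
  have "b * dx \<le> 0" "0 \<le> b * dx" using upper line bx y by (auto simp: algebra_simps)
  then have "dx = 0" using b_pos by simp
  then show ?thesis using y by (simp add: dx_def)
qed

text \<open>Below the ray Y = u * X, the RLT constraint and the chord leave only points of the
  triangle ERT, where E is the level-z point of the segment from (l / b, b, l) to (1, u, u). The
  side ER is on the line z = b * x + y - b.\<close>

lemma cone2_line_part:
  assumes z: "l \<le> z" "z \<le> u"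
    and part: "(u - l) * y - b * (u - z) < u * ((u - l) * x - l / b * (u - z))"
    and line: "z \<le> b * x + y - b"
    and chord: "0 \<le> (max z a - z / max z b) * (y - max z b) - (z / max z a - max z b) * (x - z / max z b)"
  shows "(x, y, z) \<in> convex hull slab a b l u"
proof -
  let ?H = "convex hull slab a b l u"
  note c = corner_bounds[OF z]
  note c' = region_A.corner_bounds[OF swap z]
  have u0: "0 < u" using l_pos l_less_u by simp
  define tx where "tx = max z a"
  define ty where "ty = z / max z a"
  define rx where "rx = z / max z b"
  define ry where "ry = max z b"
  define x' where "x' = l / b"
  have bx': "b * x' = l" using b_pos by (simp add: x'_def)
  \<comment> \<open>This form is Y - u * X: zero at E, at most zero at R, nonnegative at T.\<close>
  define g where "g = (\<lambda>p q. (u - l) * q - b * (u - z) - u * ((u - l) * p - x' * (u - z)))"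
  have gp: "g x y < 0" using part by (simp add: g_def x'_def)
  note cor = cone2_corners[OF z, folded tx_def ty_def rx_def ry_def x'_def]
  have gR: "g rx ry \<le> 0" using cor(2) by (simp add: g_def)
  have gT: "0 \<le> g tx ty"
  proof -
    define TX where "TX = (u - l) * tx - x' * (u - z)"
    define TY where "TY = (u - l) * ty - b * (u - z)"
    have "0 \<le> b * (z - l)" using b_pos z by simp
    then have TY: "0 \<le> TY" "b\<^sup>2 * TX < l * TY"
      using cor(3,4) unfolding TX_def TY_def by linarith+
    have "u * TX \<le> TY"
    proof (cases "TX \<le> 0")
      case True
      then show ?thesis using TY u0 by (smt (verit) mult_nonneg_nonpos)
    next
      case False
      then have "l * u * TX \<le> b\<^sup>2 * TX" using lu_le_b2 by (intro mult_right_mono) auto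
      then have "l * (u * TX) \<le> l * TY" using TY by (simp add: mult.assoc)
      then show ?thesis using l_pos by (simp only: mult_le_cancel_left_pos)
    qed
    then show ?thesis by (simp add: g_def TX_def TY_def)
  qed
  have lR: "b * rx + ry = b + z"
  proof (cases "z \<le> b")
    case True
    then show ?thesis using b_pos by (simp add: rx_def ry_def)
  next
    case False
    then show ?thesis using z l_pos by (simp add: rx_def ry_def)
  qed
  have lT: "0 < b * tx + ty - b - z"
  proof -
    have "b * tx \<le> max z b * tx" using c(1) by (intro mult_right_mono) (auto simp: tx_def)
    then have "b * tx < z" using c(6) by (simp only: mult.commute tx_def)
    then have "b < ty" using c(1) by (simp add: tx_def ty_def pos_less_divide_eq)
    moreover have "tx < 1" using c(2) u_less_1 by (simp add: tx_def)
    ultimately have "0 < (ty - b) * (1 - tx)" by simp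
    moreover have "ty * tx = z" using c(1) by (simp add: tx_def ty_def)
    ultimately show ?thesis by (simp add: algebra_simps)
  qed
  \<comment> \<open>The slack of the RLT constraint, normalized to 1 at T. What remains is
    \<open>k\<close>, a displacement along the direction (1, -b) of the line through E and
    R.\<close>
  define t where "t = (b * x + y - b - z) / (b * tx + ty - b - z)"
  have t0: "0 \<le> t" using line lT by (simp add: t_def)
  have tl: "t * (b * tx + ty - b - z) = b * x + y - b - z" using lT by (simp add: t_def)
  define k where "k = x - t * tx - (1 - t) * rx"
  have kx: "x = t * tx + (1 - t) * rx + k" by (simp add: k_def)
  have ky: "y = t * ty + (1 - t) * ry - b * k" using tl lR unfolding k_def by algebra
  have "(tx - rx) * (y - ry) - (ty - ry) * (x - rx) = - (k * (b * tx + ty - b - z))"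
    using lR unfolding kx ky by algebra
  then have "k * (b * tx + ty - b - z) \<le> 0" using chord by (simp add: tx_def ty_def rx_def ry_def)
  then have k0: "k \<le> 0" using lT by (simp add: mult_le_0_iff)
  define \<nu> where "\<nu> = (z - l) / (u - l)"
  have \<nu>: "0 \<le> \<nu>" "\<nu> \<le> 1" and \<nu>z: "\<nu> * (u - l) = z - l" using z l_less_u by (auto simp: \<nu>_def)
  define ex where "ex = (1 - \<nu>) * x' + \<nu>"
  define ey where "ey = (1 - \<nu>) * b + \<nu> * u"
  have A: "(x', b, l) \<in> ?H"
    using corner_mem'[of l] l_less_u l_less_b by (simp add: x'_def max_def)
  have B: "(1, u, u) \<in> ?H"
    using u_less_1 a_le_u b_le_u l_less_u by (intro hull_inc) (auto simp: slab_def)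
  have "(1 - \<nu>) *\<^sub>R (x', b, l) + \<nu> *\<^sub>R (1, u, u) \<in> ?H"
    using \<nu> by (intro convexD[OF convex_convex_hull] A B) auto
  moreover have zl: "(1 - \<nu>) * l + \<nu> * u = z" using \<nu>z by (simp add: algebra_simps)
  ultimately have E: "(ex, ey, z) \<in> ?H" by (simp add: ex_def ey_def)
  define kE where "kE = ex - rx"
  have kEx: "ex = rx + kE" by (simp add: kE_def)
  have kEy: "ey = ry - b * kE" using lR zl bx' unfolding kE_def ex_def ey_def by algebra
  have "g ex ey = 0" using \<nu>z unfolding g_def ex_def ey_def by algebra
  then have gE: "(u - l) * (b + u) * kE = g rx ry" unfolding g_def kEx kEy by (simp add: algebra_simps)
  have gp2: "g x y = t * g tx ty + (1 - t) * g rx ry - (u - l) * (b + u) * k"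
    unfolding g_def kx ky by (simp add: algebra_simps)
  have "(u - l) * (b + u) * k \<le> 0" using k0 l_less_u b_pos u0 by (simp add: mult_le_0_iff)
  \<comment> \<open>The other two terms of \<open>g x y\<close> are nonnegative, so R is strictly
    below the ray; hence E differs from R and division by \<open>kE\<close> is possible.\<close>
  then have "(1 - t) * g rx ry < 0" using gp gp2 t0 gT mult_nonneg_nonneg[OF t0 gT] by linarith
  then have gR': "g rx ry < 0" using gR by (cases "g rx ry = 0") auto
  then have "(u - l) * (b + u) * kE < 0" using gE by simp
  then have kE: "kE < 0" using l_less_u b_pos u0 by (simp add: mult_less_0_iff)
  define e where "e = k / kE"
  have e: "0 \<le> e" "k = e * kE" using k0 kE by (auto simp: e_def divide_nonpos_neg)
  have "g x y = t * g tx ty + (1 - t - e) * g rx ry"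
    unfolding gp2 e gE[symmetric] by (simp add: algebra_simps)
  then have "(1 - t - e) * g rx ry < 0" using gp mult_nonneg_nonneg[OF t0 gT] by linarith
  then have e1: "0 \<le> 1 - t - e" using gR' by (simp add: mult_less_0_iff)
  have T: "(tx, ty, z) \<in> ?H" using corner_mem[OF z] by (simp add: tx_def ty_def)
  have R: "(rx, ry, z) \<in> ?H" using corner_mem'[OF z] by (simp add: rx_def ry_def)
  show ?thesis
    by (rule tri_mem[OF convex_convex_hull E R T e(1) e1 t0])
       (auto simp: kx ky kEx kEy e algebra_simps)
qed

text \<open>The origin of the cone is the point at which both factors of the second-order cone constraint vanish.\<close>
lemma cone2_soc_part:
  assumes z: "l < z" "z \<le> u"
    and X: "X = (u - l) * x - l / b * (u - z)" and Y: "Y = (u - l) * y - b * (u - z)"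
    and part: "u * X \<le> Y"
    and reg: "y \<le> b\<^sup>2 / l * x"
    and soc: "u * (z - l)\<^sup>2 \<le> X * Y"
    and line: "z \<le> b * x + y - b"
    and chord: "0 \<le> (max z a - z / max z b) * (y - max z b) - (z / max z a - max z b) * (x - z / max z b)"
  shows "(x, y, z) \<in> convex hull slab a b l u"
proof -
  let ?H = "convex hull slab a b l u"
  have z': "l \<le> z" using z by simp
  have u0: "0 < u" using l_pos l_less_u by simp
  have reg': "l * Y \<le> b\<^sup>2 * X"
  proof -
    have "l * y \<le> b\<^sup>2 * x" using reg l_pos by (simp add: field_simps)
    then have "(u - l) * (l * y) \<le> (u - l) * (b\<^sup>2 * x)" using l_less_u by (intro mult_left_mono) auto
    moreover have "b\<^sup>2 * (l / b * (u - z)) = l * (b * (u - z))" using b_pos by (simp add: power2_eq_square)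
    ultimately show ?thesis unfolding X Y right_diff_distrib by (simp add: mult.left_commute)
  qed
  have "0 < u * (z - l)\<^sup>2" using u0 z by simp
  then have XY: "0 < X * Y" using soc by simp
  \<comment> \<open>The second-order cone constraint only gives X * Y > 0; the RLT inequality
    excludes that both factors are negative.\<close>
  have "b * X + Y \<ge> (u + b) * (z - l)"
  proof -
    have "(u - l) * (z + b) \<le> (u - l) * (b * x + y)" using line l_less_u by (intro mult_left_mono) auto
    moreover have "b * (l / b * (u - z)) = l * (u - z)" using b_pos by simp
    then have "b * X = (u - l) * (b * x) - l * (u - z)" unfolding X right_diff_distrib by simp
    ultimately show ?thesis by (simp add: Y algebra_simps)
  qed
  moreover have "(u + b) * (z - l) > 0" using u0 b_pos z by simp
  ultimately have "\<not> (X < 0 \<and> Y < 0)" using b_pos by (smt (verit) mult_pos_neg)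
  then have X0: "0 < X" and Y0: "0 < Y" using XY by (auto simp: zero_less_mult_iff)
  \<comment> \<open>The end point (su * k, su / k) must stay in the unit square: u * Y \<le> X gives
    su / k \<le> 1, and \<open>part\<close> gives su * k \<le> 1.\<close>
  have uY: "u * Y \<le> X"
  proof -
    have "l * (u * b\<^sup>2) \<le> a\<^sup>2 * b\<^sup>2" using mult_right_mono[OF lu_le_a2, of "b\<^sup>2"] by (simp add: mult.assoc)
    then have "l * (u * b\<^sup>2) \<le> l * l" using slope_less by (simp add: power2_eq_square)
    then have "u * b\<^sup>2 \<le> l" using l_pos by (simp only: mult_le_cancel_left_pos)
    then have "u * b\<^sup>2 * X \<le> l * X" using X0 by (intro mult_right_mono) auto
    moreover have "u * (l * Y) \<le> u * (b\<^sup>2 * X)" using reg' u0 by (intro mult_left_mono) auto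
    ultimately have "l * (u * Y) \<le> l * X" by (simp add: algebra_simps)
    then show ?thesis using l_pos by (simp only: mult_le_cancel_left_pos)
  qed
  define su where "su = sqrt u"
  have su: "0 < su" "su\<^sup>2 = u" using u0 by (auto simp: su_def)
  define g where "g = sqrt (X * Y)"
  define k where "k = sqrt (X / Y)"
  have g0: "0 < g" and k0: "0 < k" using X0 Y0 by (auto simp: g_def k_def)
  have k2: "k\<^sup>2 = X / Y" using X0 Y0 by (simp add: k_def)
  have Xg: "X = g * k" and Yg: "Y = g / k"
    using X0 Y0 by (simp_all add: g_def k_def real_sqrt_mult[symmetric] real_sqrt_divide[symmetric] field_simps)
  have "(su * (z - l))\<^sup>2 \<le> g\<^sup>2" using soc XY su by (simp add: g_def power_mult_distrib)
  then have sg: "su * (z - l) \<le> g" by (rule power2_le_imp_le) (use g0 in auto)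
  have k2_bounds: "su\<^sup>2 \<le> k\<^sup>2" "(su * k)\<^sup>2 \<le> 1\<^sup>2"
    using uY part Y0 X0 su unfolding power_mult_distrib k2 by (auto simp: field_simps)
  have sk: "su \<le> k" "su * k \<le> 1"
    using power2_le_imp_le[OF k2_bounds(1)] power2_le_imp_le[OF k2_bounds(2)] k0 by auto
  have "su * su \<le> su * k" using sk su by (intro mult_left_mono) auto
  then have uk: "u \<le> su * k" using su(2) by (simp only: power2_eq_square)
  have "su * (su * k) \<le> su * 1" using sk su by (intro mult_left_mono) auto
  then have "u * k \<le> su" unfolding su(2)[symmetric] by (simp add: power2_eq_square mult.assoc)
  then have uk': "u \<le> su / k" using k0 by (simp add: field_simps)
  have B: "(su * k, su / k, u) \<in> ?H"
    using su k0 sk uk uk' a_le_u b_le_u l_less_u by (intro slab_point) auto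
  define x' where "x' = l / b"
  have A: "(x', b, l) \<in> ?H"
    using corner_mem'[of l] l_less_u l_less_b by (simp add: x'_def max_def)
  define \<nu> where "\<nu> = (z - l) / (u - l)"
  have \<nu>: "0 \<le> \<nu>" "\<nu> \<le> 1" and \<nu>z: "\<nu> * (u - l) = z - l" using z l_less_u by (auto simp: \<nu>_def)
  have "(1 - \<nu>) *\<^sub>R (x', b, l) + \<nu> *\<^sub>R (su * k, su / k, u) \<in> ?H"
    using \<nu> by (intro convexD[OF convex_convex_hull] A B) auto
  moreover have zl: "(1 - \<nu>) * l + \<nu> * u = z" using \<nu>z by (simp add: algebra_simps)
  ultimately have W: "((1 - \<nu>) * x' + \<nu> * (su * k), (1 - \<nu>) * b + \<nu> * (su / k), z) \<in> ?H" by simp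
  have offset: "p - (1 - \<nu>) * q = ((u - l) * p - q * (u - z)) / (u - l)" for p q
  proof -
    have "(u - l) * (p - (1 - \<nu>) * q) = (u - l) * p - q * (u - z)" using \<nu>z by algebra
    then show ?thesis using l_less_u by (simp add: field_simps)
  qed
  have ul: "0 < u - l" using l_less_u by simp
  have det: "p / (u - l) * (q / (u - l)) - r / (u - l) * (v / (u - l)) = (p * q - r * v) / (u - l)\<^sup>2" for p q r v
    by (simp add: power2_eq_square diff_divide_distrib)
  define RX where "RX = (u - l) * (z / max z b) - x' * (u - z)"
  define RY where "RY = (u - l) * max z b - b * (u - z)"
  define TX where "TX = (u - l) * max z a - x' * (u - z)"
  define TY where "TY = (u - l) * (z / max z a) - b * (u - z)"
  have off: "x - (1 - \<nu>) * x' = X / (u - l)" "y - (1 - \<nu>) * b = Y / (u - l)"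
    "z / max z b - (1 - \<nu>) * x' = RX / (u - l)" "max z b - (1 - \<nu>) * b = RY / (u - l)"
    "max z a - (1 - \<nu>) * x' = TX / (u - l)" "z / max z a - (1 - \<nu>) * b = TY / (u - l)"
    unfolding offset X Y RX_def RY_def TX_def TY_def x'_def by simp_all
  note cor = cone2_corners[OF z' z(2), folded x'_def, folded RX_def RY_def TX_def TY_def]
  have "0 < b * (z - l)" using z b_pos by simp
  then have TY: "0 < TY" using cor(3) by linarith
  have lT: "b\<^sup>2 * TX < l * TY" by (rule cor(4))
  have RX: "0 < RX" using cor(1) z by simp
  have "(u - l) * b \<le> (u - l) * max z b" using ul by (intro mult_left_mono) auto
  then have RY: "0 \<le> RY" using \<open>0 < b * (z - l)\<close> by (simp add: RY_def algebra_simps)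
  \<comment> \<open>If \<open>TX\<close> is positive, slopes are chained: RY / RX \<le> u \<le> b^2
    / l < TY / TX.\<close>
  have D: "0 < RX * TY - RY * TX"
  proof (cases "TX \<le> 0")
    case True
    then have "RY * TX \<le> 0" using RY by (simp add: mult_nonneg_nonpos)
    moreover have "0 < RX * TY" using RX TY by simp
    ultimately show ?thesis by linarith
  next
    case False
    have "RY * TX \<le> u * RX * TX" using cor(2) False by (intro mult_right_mono) auto
    then have "l * (RY * TX) \<le> l * (u * RX * TX)" using l_pos by (intro mult_left_mono) auto
    also have "\<dots> = l * u * (RX * TX)" by simp
    also have "\<dots> \<le> b\<^sup>2 * (RX * TX)" using lu_le_b2 RX False by (intro mult_right_mono) auto
    also have "\<dots> = RX * (b\<^sup>2 * TX)" by simp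
    also have "\<dots> < RX * (l * TY)" using lT RX by (intro mult_strict_left_mono) auto
    finally have "l * (RY * TX) < l * (RX * TY)" by (simp add: mult.left_commute)
    then show ?thesis using l_pos by (simp only: mult_less_cancel_left_pos diff_gt_0_iff_gt)
  qed
  have R_side: "0 \<le> RX * Y - RY * X"
  proof -
    have "RY * X \<le> u * RX * X" using cor(2) X0 by (intro mult_right_mono) auto
    also have "\<dots> = RX * (u * X)" by simp
    also have "\<dots> \<le> RX * Y" using part RX by (intro mult_left_mono) auto
    finally show ?thesis by simp
  qed
  have T_side: "0 \<le> X * TY - Y * TX"
  proof (cases "TX \<le> 0")
    case True
    then show ?thesis using X0 Y0 TY by (smt (verit) mult_nonneg_nonneg mult_nonneg_nonpos)
  next
    case False
    have "l * (Y * TX) \<le> b\<^sup>2 * X * TX" using reg' False mult_right_mono[OF reg', of TX] by (simp add: mult.assoc)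
    also have "\<dots> = X * (b\<^sup>2 * TX)" by simp
    also have "\<dots> \<le> X * (l * TY)" using lT X0 by (intro mult_left_mono) auto
    finally have "l * (Y * TX) \<le> l * (X * TY)" by (simp add: mult.left_commute)
    then show ?thesis using l_pos by (simp only: mult_le_cancel_left_pos diff_ge_0_iff_ge)
  qed
  show ?thesis
  proof (rule cone_mem[OF convex_convex_hull _ _ corner_mem[OF z' z(2)] corner_mem'[OF z' z(2)] _ _ _ chord,
        where s = "g / (su * (z - l))" and ox = "(1 - \<nu>) * x'" and oy = "(1 - \<nu>) * b"], unfold off det)
    \<comment> \<open>The ratio of the offsets of (x, y) and W from the apex; the second-order cone
      constraint says that it is at least 1.\<close>
    show "1 \<le> g / (su * (z - l))" using sg su z by simp
    have "X / (u - l) / (g / (su * (z - l))) = \<nu> * (su * k)"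
      "Y / (u - l) / (g / (su * (z - l))) = \<nu> * (su / k)"
      using g0 k0 su z ul by (auto simp: Xg Yg \<nu>_def field_simps)
    then show "((1 - \<nu>) * x' + X / (u - l) / (g / (su * (z - l))), 
       (1 - \<nu>) * b + Y / (u - l) / (g / (su * (z - l))), z) \<in> ?H" using W by simp
  qed (use D R_side T_side ul in auto)
qed

lemma cone2_region:
  assumes z: "l \<le> z" "z \<le> u"
    and reg: "y \<le> b\<^sup>2 / l * x"
    and soc: "u * (z - l)\<^sup>2 \<le> ((u - l) * x - l / b * (u - z)) * ((u - l) * y - b * (u - z))"
    and line: "z \<le> b * x + y - b"
    and upper: "z \<ge> x + y - 1" "z \<ge> b * x + a * y - a * b"
  shows "(x, y, z) \<in> convex hull slab a b l u"
proof (cases "(max z a - z / max z b) * (y - max z b) - (z / max z a - max z b) * (x - z / max z b) < 0")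
  case True
  then show ?thesis using above_chord assms by blast
next
  case False
  then have chord: "0 \<le> (max z a - z / max z b) * (y - max z b) - (z / max z a - max z b) * (x - z / max z b)"
    by simp
  consider "z = l" | "l < z" "u * ((u - l) * x - l / b * (u - z)) \<le> (u - l) * y - b * (u - z)"
    | "(u - l) * y - b * (u - z) < u * ((u - l) * x - l / b * (u - z))" using z by linarith
  then show ?thesis
  proof cases
    case 1
    then have "x = l / b \<and> y = b" using cone2_base_region reg upper line by blast
    then show ?thesis using corner_mem'[of l] l_less_u l_less_b 1 by (simp add: max_def)
  next
    case 2
    then show ?thesis using cone2_soc_part z reg soc line chord by blast
  next
    case 3
    then show ?thesis using cone2_line_part z line chord by blast
  qed
qed

section \<open>Necessity of the second-order cone constraints\<close>

text \<open>For fixed slope parameter \<open>k\<close> the constraint is the tangent plane of the cone along a ray;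
  it holds on the whole slab because \<open>sqrt (x * y)\<close> lies between \<open>sqrt l\<close> and \<open>sqrt u\<close>.\<close>
lemma cone1_valid:
  assumes H: "(x, y, z) \<in> convex hull slab a b l u"
    and xy: "0 < x" "0 < y"
  shows "(z + sqrt (l * u))\<^sup>2 \<le> (sqrt l + sqrt u)\<^sup>2 * (x * y)"
proof -
  define sl where "sl = sqrt l"
  define su where "su = sqrt u"
  have sl: "0 < sl" "sl\<^sup>2 = l" and su: "0 < su" "su\<^sup>2 = u" and slsu: "sqrt (l * u) = sl * su"
    using l_pos l_less_u by (auto simp: sl_def su_def real_sqrt_mult)
  \<comment> \<open>At the given point \<open>k * x\<close> and \<open>y / k\<close> agree, so the
    arithmetic-geometric mean inequality is sharp there.\<close>
  define k where "k = sqrt (y / x)"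
  have k0: "0 < k" using xy by (simp add: k_def)
  have "2 * (sl * su) \<le> ((sl + su) * k) * x + ((sl + su) / k) * y + (- 2) * z"
  proof (rule convex_hull_linear_ge[OF H])
    fix x y z assume "(x, y, z) \<in> slab a b l u"
    then have p: "z = x * y" "0 < x" "0 < y" "l \<le> z" "z \<le> u" using a_pos b_pos by (auto simp: slab_def)
    define w where "w = sqrt z"
    have w: "w\<^sup>2 = z" "0 \<le> w" using p l_pos by (auto simp: w_def)
    have "sl \<le> w" "w \<le> su" using p by (auto simp: sl_def su_def w_def)
    then have "0 \<le> (w - sl) * (su - w)" by simp
    then have 1: "2 * (sl * su) + 2 * z \<le> 2 * (sl + su) * w"
      unfolding w(1)[symmetric] by (simp add: power2_eq_square algebra_simps)
    have "2 * w \<le> k * x + y / k"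
    proof (rule power2_le_imp_le)
      have "(k * x + y / k)\<^sup>2 - (2 * w)\<^sup>2 = (k * x - y / k)\<^sup>2"
        using k0 by (simp add: power_mult_distrib w(1) p(1)) (simp add: power2_eq_square field_simps)
      then show "(2 * w)\<^sup>2 \<le> (k * x + y / k)\<^sup>2" by (smt (verit) zero_le_power2)
    qed (use k0 p in simp)
    then have "(sl + su) * (2 * w) \<le> (sl + su) * (k * x + y / k)"
      using sl su by (intro mult_left_mono) auto
    with 1 show "2 * (sl * su) \<le> ((sl + su) * k) * x + ((sl + su) / k) * y + (- 2) * z"
      by (simp add: algebra_simps add_divide_distrib)
  qed
  moreover have "k * x = sqrt (x * y)" "y / k = sqrt (x * y)"
    using xy by (simp_all add: k_def real_sqrt_mult real_sqrt_divide field_simps)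
  moreover have "((sl + su) * k) * x + ((sl + su) / k) * y = (sl + su) * (k * x + y / k)"
    by (simp add: algebra_simps add_divide_distrib)
  ultimately have "z + sl * su \<le> (sl + su) * sqrt (x * y)" by simp
  moreover have "l \<le> 0 * x + 0 * y + 1 * z"
    by (rule convex_hull_linear_ge[OF H]) (simp add: slab_def)
  then have "0 \<le> z + sl * su" using l_pos sl su by simp
  ultimately have "(z + sl * su)\<^sup>2 \<le> ((sl + su) * sqrt (x * y))\<^sup>2" by (intro power_mono)
  then show ?thesis using xy unfolding slsu by (simp add: power_mult_distrib sl_def su_def)
qed

text \<open>On the slab, \<open>X * Y - u * (z - l)\<^sup>2 = (u - l) * (u - z) * (x - l / b) * (y - b)\<close>, so the
  constraint itself can fail for \<open>x < l / b\<close>, but its tangent planes with small slope parameter hold.\<close>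
lemma cone2_tangent_valid:
  assumes p: "(x, y, z) \<in> slab a b l u" and \<sigma>: "0 < \<sigma>" "l * \<sigma>\<^sup>2 \<le> b\<^sup>2"
  shows "2 * sqrt u * (z - l) \<le> \<sigma> * ((u - l) * x - l / b * (u - z)) + ((u - l) * y - b * (u - z)) / \<sigma>"
proof -
  have u0: "0 < u" using l_pos l_less_u by simp
  define x' where "x' = l / b"
  have bx': "b * x' = l" using b_pos by (simp add: x'_def)
  define X where "X = (u - l) * x - x' * (u - z)"
  define Y where "Y = (u - l) * y - b * (u - z)"
  have q: "z = x * y" "a \<le> x" "b \<le> y" "l \<le> z" "z \<le> u" using p by (auto simp: slab_def)
  have "(u - l) * b \<le> (u - l) * y" using q l_less_u by (intro mult_left_mono) auto
  moreover have "0 \<le> b * (z - l)" using q b_pos by simp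
  ultimately have Y0: "0 \<le> Y" by (simp add: Y_def algebra_simps)
  have AMGM: "2 * sqrt u * (z - l) \<le> s * X + Y / s" if s: "0 < s" "0 \<le> X" and XY: "u * (z - l)\<^sup>2 \<le> X * Y" for s
  proof (rule power2_le_imp_le)
    have "(s * X + Y / s)\<^sup>2 - 4 * (X * Y) = (s * X - Y / s)\<^sup>2"
      using s by (simp add: power2_eq_square field_simps)
    then have "4 * (X * Y) \<le> (s * X + Y / s)\<^sup>2" by (smt (verit) zero_le_power2)
    then show "(2 * sqrt u * (z - l))\<^sup>2 \<le> (s * X + Y / s)\<^sup>2"
      using XY u0 by (simp add: power_mult_distrib)
  qed (use s Y0 in simp)
  have "2 * sqrt u * (z - l) \<le> \<sigma> * X + Y / \<sigma>"
  proof (cases "x' \<le> x")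
    case True
    have "X * Y - u * (z - l)\<^sup>2 = (u - l) * (u - z) * ((x - x') * (y - b))"
      unfolding X_def Y_def q(1) bx'[symmetric] by (simp add: power2_eq_square algebra_simps)
    moreover have "0 \<le> (u - l) * (u - z) * ((x - x') * (y - b))"
      using True q l_less_u by (intro mult_nonneg_nonneg) auto
    ultimately have XY: "u * (z - l)\<^sup>2 \<le> X * Y" by simp
    have "(u - l) * x' \<le> (u - l) * x" using True l_less_u by (intro mult_left_mono) auto
    moreover have "0 \<le> x' * (z - l)" using q l_pos b_pos by (simp add: x'_def)
    ultimately have "0 \<le> X" by (simp add: X_def algebra_simps)
    then show ?thesis using AMGM \<sigma>(1) XY by blast
  next
    case False
    \<comment> \<open>The largest admissible slope parameter, for which s * x' = b / s = sqrt l. The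
      inequality is proved at \<open>s\<close> and carried over to the smaller
      \<open>\<sigma>\<close>.\<close>
    define s where "s = b / sqrt l"
    have s: "0 < s" "l * s\<^sup>2 = b\<^sup>2" using b_pos l_pos by (auto simp: s_def power_divide)
    have sl: "sqrt l * sqrt l = l" "0 < sqrt l" using l_pos by auto
    have su: "sqrt u * sqrt u = u" using u0 by simp
    have sx': "s * x' = sqrt l" using sl b_pos by (simp add: s_def x'_def field_simps)
    have bs: "b / s = sqrt l" using b_pos by (simp add: s_def)
    have "\<sigma>\<^sup>2 \<le> s\<^sup>2" using \<sigma>(2) s l_pos by (metis mult_le_cancel_left_pos)
    then have \<sigma>s: "\<sigma> \<le> s" by (rule power2_le_imp_le) (use s in auto)
    have "s\<^sup>2 * X \<le> Y"
    proof -
      have "b * (b * x) \<le> b * (b * x')" using False b_pos by (intro mult_left_mono) auto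
      also have "\<dots> = b * l" using bx' by simp
      also have "\<dots> \<le> l * y" using q l_pos by (simp add: mult.commute)
      finally have "(u - l) * (b\<^sup>2 * x) \<le> (u - l) * (l * y)"
        using l_less_u by (intro mult_left_mono) (auto simp: power2_eq_square)
      moreover have "b\<^sup>2 * (x' * (u - z)) = l * (b * (u - z))"
        unfolding bx'[symmetric] by (simp add: power2_eq_square)
      ultimately have "b\<^sup>2 * X \<le> l * Y" unfolding X_def Y_def right_diff_distrib by (simp add: mult.left_commute)
      then have "l * (s\<^sup>2 * X) \<le> l * Y" using s by (simp add: mult.assoc[symmetric])
      then show ?thesis using l_pos by (simp only: mult_le_cancel_left_pos)
    qed
    then have ssX: "s * (s * X) \<le> Y" by (simp add: power2_eq_square mult.assoc)
    have "\<sigma> * (s * X) \<le> Y"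
    proof (cases "0 \<le> X")
      case True
      then have "\<sigma> * (s * X) \<le> s * (s * X)" using \<sigma>s s by (intro mult_right_mono) auto
      then show ?thesis using ssX by linarith
    next
      case False
      then show ?thesis using s \<sigma> Y0 by (smt (verit) mult_nonneg_nonpos)
    qed
    \<comment> \<open>Expanding this product shows that the bound cannot decrease when the slope
      parameter drops from \<open>s\<close> to \<open>\<sigma>\<close>.\<close>
    then have "0 \<le> (s - \<sigma>) * (Y - \<sigma> * (s * X))" using \<sigma>s by simp
    then have "s * (Y - \<sigma> * (s * X)) + \<sigma> * (\<sigma> * (s * X)) \<ge> \<sigma> * Y" by (simp add: algebra_simps)
    then have mono: "s * X + Y / s \<le> \<sigma> * X + Y / \<sigma>" using s \<sigma> by (simp add: field_simps)
    define w where "w = sqrt z"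
    have w: "w * w = z" "0 \<le> w" using q l_pos by (auto simp: w_def)
    have "sqrt l \<le> w" "w \<le> sqrt u" using q by (auto simp: w_def)
    then have 1: "0 \<le> (w - sqrt l) * (sqrt u - w)" by simp
    have "2 * w \<le> s * x + y / s"
    proof (rule power2_le_imp_le)
      have "(s * x + y / s)\<^sup>2 - 4 * z = (s * x - y / s)\<^sup>2"
        using s by (simp add: q(1) power2_eq_square field_simps)
      then show "(2 * w)\<^sup>2 \<le> (s * x + y / s)\<^sup>2"
        using w by (simp add: power2_eq_square[of w] power_mult_distrib) (smt (verit) zero_le_power2)
    qed (use s q a_pos b_pos in simp)
    then have "(u - l) * (2 * w) \<le> (u - l) * (s * x + y / s)" using l_less_u by (intro mult_left_mono) auto
    moreover have "s * X + Y / s = (u - l) * (s * x + y / s) - (s * x' + b / s) * (u - z)"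
      by (simp add: X_def Y_def algebra_simps diff_divide_distrib add_divide_distrib)
    then have "s * X + Y / s = (u - l) * (s * x + y / s) - 2 * sqrt l * (u - z)"
      unfolding sx' bs by simp
    moreover have "0 \<le> 2 * (sqrt u - sqrt l) * ((w - sqrt l) * (sqrt u - w))"
      using 1 l_less_u by simp
    moreover have "2 * (q - p) * ((w - p) * (q - w))
        = (q * q - p * p) * (2 * w) - 2 * p * (q * q - w * w) - 2 * q * (w * w - p * p)" for p q :: real
      by (simp add: algebra_simps)
    from this[of "sqrt u" "sqrt l"] have "2 * (sqrt u - sqrt l) * ((w - sqrt l) * (sqrt u - w))
        = (u - l) * (2 * w) - 2 * sqrt l * (u - z) - 2 * sqrt u * (z - l)"
      unfolding w(1) sl(1) su .
    ultimately have "2 * sqrt u * (z - l) \<le> s * X + Y / s" by linarith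
    then show ?thesis using mono by linarith
  qed
  then show ?thesis by (simp add: X_def Y_def x'_def)
qed

text \<open>The tangent inequalities are optimized over \<sigma>: \<sigma> * X + Y / \<sigma> is
  smallest at sqrt (Y / X), and the region condition is exactly what makes this parameter
  admissible.\<close>

lemma cone2_valid:
  assumes H: "(x, y, z) \<in> convex hull slab a b l u"
    and reg: "y \<le> b\<^sup>2 / l * x"
  shows "u * (z - l)\<^sup>2 \<le> ((u - l) * x - l / b * (u - z)) * ((u - l) * y - b * (u - z))"
proof -
  have u0: "0 < u" using l_pos l_less_u by simp
  define x' where "x' = l / b"
  have bx': "b * x' = l" using b_pos by (simp add: x'_def)
  define X where "X = (u - l) * x - x' * (u - z)"
  define Y where "Y = (u - l) * y - b * (u - z)"
  have tangent: "2 * sqrt u * (z - l) \<le> \<sigma> * X + Y / \<sigma>" if \<sigma>: "0 < \<sigma>" "l * \<sigma>\<^sup>2 \<le> b\<^sup>2" for \<sigma>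
  proof -
    have "\<sigma> * (x' * u) + b * u / \<sigma> - 2 * sqrt u * l
        \<le> (\<sigma> * (u - l)) * x + ((u - l) / \<sigma>) * y + (\<sigma> * x' + b / \<sigma> - 2 * sqrt u) * z"
    proof (rule convex_hull_linear_ge[OF H])
      fix x y z assume "(x, y, z) \<in> slab a b l u"
      from cone2_tangent_valid[OF this \<sigma>]
      show "\<sigma> * (x' * u) + b * u / \<sigma> - 2 * sqrt u * l
        \<le> (\<sigma> * (u - l)) * x + ((u - l) / \<sigma>) * y + (\<sigma> * x' + b / \<sigma> - 2 * sqrt u) * z"
        unfolding x'_def[symmetric] by (simp add: algebra_simps diff_divide_distrib add_divide_distrib)
    qed
    then show ?thesis
      unfolding X_def Y_def by (simp add: algebra_simps diff_divide_distrib add_divide_distrib)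
  qed
  have zl: "l \<le> 0 * x + 0 * y + 1 * z"
    by (rule convex_hull_linear_ge[OF H]) (simp add: slab_def)
  have yb: "b \<le> 0 * x + 1 * y + 0 * z"
    by (rule convex_hull_linear_ge[OF H]) (simp add: slab_def)
  have "(u - l) * b \<le> (u - l) * y" using yb l_less_u by (intro mult_left_mono) auto
  moreover have "0 \<le> b * (z - l)" using zl b_pos by simp
  ultimately have Y0: "0 \<le> Y" by (simp add: Y_def algebra_simps)
  have reg': "l * Y \<le> b\<^sup>2 * X"
  proof -
    have "l * y \<le> b\<^sup>2 * x" using reg l_pos by (simp add: field_simps)
    then have "(u - l) * (l * y) \<le> (u - l) * (b\<^sup>2 * x)" using l_less_u by (intro mult_left_mono) auto
    moreover have "b\<^sup>2 * (x' * (u - z)) = l * (b * (u - z))"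
        unfolding bx'[symmetric] by (simp add: power2_eq_square)
    ultimately show ?thesis unfolding X_def Y_def right_diff_distrib by (simp add: mult.left_commute)
  qed
  have "0 \<le> l * Y" using Y0 l_pos by simp
  then have X0: "0 \<le> X" using reg' b_pos by (smt (verit) mult_pos_neg zero_less_power)
  have "u * (z - l)\<^sup>2 \<le> X * Y"
  proof (cases "Y = 0")
    case True
    have "z \<le> l"
    proof (rule ccontr)
      assume "\<not> z \<le> l"
      then have P: "0 < sqrt u * (z - l)" using u0 by simp
      \<comment> \<open>For Y = 0 the bound is \<sigma> * X, so a small parameter contradicts z > l.
        The summand 1 in the denominator covers X = 0.\<close>
      define \<sigma> where "\<sigma> = min (b / sqrt l) (sqrt u * (z - l) / (X + 1))"
      have s: "0 < b / sqrt l" "l * (b / sqrt l)\<^sup>2 = b\<^sup>2" using b_pos l_pos by (auto simp: power_divide)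
      have "0 < \<sigma>" using s P X0 by (simp add: \<sigma>_def)
      have "\<sigma>\<^sup>2 \<le> (b / sqrt l)\<^sup>2" using \<open>0 < \<sigma>\<close> by (intro power_mono) (auto simp: \<sigma>_def)
      then have "l * \<sigma>\<^sup>2 \<le> b\<^sup>2" using s l_pos by (metis mult_le_cancel_left_pos)
      then have "2 * (sqrt u * (z - l)) \<le> \<sigma> * X" using tangent[OF \<open>0 < \<sigma>\<close>] True by simp
      also have "\<dots> \<le> \<sigma> * (X + 1)" using \<open>0 < \<sigma>\<close> by simp
      also have "\<dots> \<le> sqrt u * (z - l) / (X + 1) * (X + 1)"
        using X0 by (intro mult_right_mono) (auto simp: \<sigma>_def)
      also have "\<dots> = sqrt u * (z - l)" using X0 by simp
      finally show False using P by simp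
    qed
    then show ?thesis using zl True by simp
  next
    case False
    then have "0 < Y" using Y0 by simp
    then have "0 < X" using reg' l_pos b_pos X0 by (cases "X = 0") (auto simp: mult_le_0_iff)
    define \<sigma> where "\<sigma> = sqrt (Y / X)"
    have \<sigma>: "0 < \<sigma>" "\<sigma>\<^sup>2 = Y / X" using \<open>0 < X\<close> \<open>0 < Y\<close> by (auto simp: \<sigma>_def)
    have "l * \<sigma>\<^sup>2 \<le> b\<^sup>2" using reg' \<open>0 < X\<close> unfolding \<sigma> by (simp add: field_simps)
    from tangent[OF \<sigma>(1) this] have "2 * sqrt u * (z - l) \<le> \<sigma> * X + Y / \<sigma>" .
    moreover have "\<sigma> * X = sqrt (X * Y)" "Y / \<sigma> = sqrt (X * Y)"
      using \<open>0 < X\<close> \<open>0 < Y\<close> by (simp_all add: \<sigma>_def real_sqrt_mult real_sqrt_divide field_simps)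
    ultimately have "sqrt u * (z - l) \<le> sqrt (X * Y)" by simp
    then have "(sqrt u * (z - l))\<^sup>2 \<le> (sqrt (X * Y))\<^sup>2" using zl u0 by (intro power_mono) auto
    then show ?thesis using u0 X0 Y0 by (simp add: power_mult_distrib)
  qed
  then show ?thesis by (simp add: X_def Y_def x'_def)
qed

end

section \<open>The exact description of the hull\<close>

text \<open>With the factors of the outer constraints written as scaled offsets from the apex, the
  third constraint is the second with x, y and a, b exchanged, up to the order of the
  factors.\<close>

lemma convex_hull_slab_iff:
  fixes a b l u :: real
  assumes "region_A a b l u"
  shows "(x, y, z) \<in> convex hull slab a b l u \<longleftrightarrow>
    z \<ge> x + y - 1 \<and> z \<ge> b * x + a * y - a * b \<and> z \<le> x + a * y - a \<and> z \<le> b * x + y - b \<and>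
    l \<le> z \<and> z \<le> u \<and>
    (b\<^sup>2 / l * x \<le> y \<and> y \<le> l / a\<^sup>2 * x \<longrightarrow>
      (z + sqrt (l * u))\<^sup>2 \<le> (sqrt l + sqrt u)\<^sup>2 * (x * y)) \<and>
    (y \<le> b\<^sup>2 / l * x \<longrightarrow>
      u * (z - l)\<^sup>2 \<le> ((u - l) * x - l / b * (u - z)) * ((u - l) * y - b * (u - z))) \<and>
    (l / a\<^sup>2 * x \<le> y \<longrightarrow>
      u * (z - l)\<^sup>2 \<le> ((u - l) * x - a * (u - z)) * ((u - l) * y - l / a * (u - z)))"
    (is "?L \<longleftrightarrow> ?R")
proof
  interpret region_A a b l u by (rule assms)
  interpret sw: region_A b a l u by (rule swap)
  assume H: ?L
  note lin = convex_hull_linear_ge[OF H]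
  have x: "a \<le> 1 * x + 0 * y + 0 * z" and y: "b \<le> 0 * x + 1 * y + 0 * z"
    and zl: "l \<le> 0 * x + 0 * y + 1 * z" and zu: "- u \<le> 0 * x + 0 * y + (- 1) * z"
    by (rule lin, simp add: slab_def)+
  have r1: "- 1 \<le> (- 1) * x + (- 1) * y + 1 * z"
  proof (rule lin)
    fix x y z assume "(x, y, z) \<in> slab a b l u"
    then have "z = x * y" "0 \<le> (1 - x) * (1 - y)" by (auto simp: slab_def)
    then show "- 1 \<le> (- 1) * x + (- 1) * y + 1 * z" by (simp add: algebra_simps)
  qed
  have r2: "- a * b \<le> (- b) * x + (- a) * y + 1 * z"
  proof (rule lin)
    fix x y z assume "(x, y, z) \<in> slab a b l u"
    then have "z = x * y" "0 \<le> (x - a) * (y - b)" by (auto simp: slab_def)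
    then show "- a * b \<le> (- b) * x + (- a) * y + 1 * z" by (simp add: algebra_simps)
  qed
  have r3: "a \<le> 1 * x + a * y + (- 1) * z"
  proof (rule lin)
    fix x y z assume "(x, y, z) \<in> slab a b l u"
    then have "z = x * y" "0 \<le> (x - a) * (1 - y)" by (auto simp: slab_def)
    then show "a \<le> 1 * x + a * y + (- 1) * z" by (simp add: algebra_simps)
  qed
  have r4: "b \<le> b * x + 1 * y + (- 1) * z"
  proof (rule lin)
    fix x y z assume "(x, y, z) \<in> slab a b l u"
    then have "z = x * y" "0 \<le> (1 - x) * (y - b)" by (auto simp: slab_def)
    then show "b \<le> b * x + 1 * y + (- 1) * z" by (simp add: algebra_simps)
  qed
  have "x \<le> a\<^sup>2 / l * y" if "l / a\<^sup>2 * x \<le> y"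
    using that l_pos a_pos by (simp add: field_simps)
  then have c3: "l / a\<^sup>2 * x \<le> y \<longrightarrow>
      u * (z - l)\<^sup>2 \<le> ((u - l) * x - a * (u - z)) * ((u - l) * y - l / a * (u - z))"
    using sw.cone2_valid[OF slab_swap[OF H]] by (simp add: mult.commute)
  have "0 < x" "0 < y" using x y a_pos b_pos by auto
  then show ?R
    using zl zu r1 r2 r3 r4 c3 cone1_valid[OF H] cone2_valid[OF H] by simp
next
  interpret region_A a b l u by (rule assms)
  interpret sw: region_A b a l u by (rule swap)
  assume R: ?R
  consider "b\<^sup>2 / l * x \<le> y" "y \<le> l / a\<^sup>2 * x" | "y \<le> b\<^sup>2 / l * x" | "l / a\<^sup>2 * x \<le> y" by linarith
  then show ?L
  proof cases
    case 1
    then show ?thesis using R by (intro cone1_region) auto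
  next
    case 2
    then show ?thesis using R by (intro cone2_region) auto
  next
    case 3
    then have "x \<le> a\<^sup>2 / l * y" using l_pos a_pos by (simp add: field_simps)
    then have "(y, x, z) \<in> convex hull slab b a l u"
      using R 3 by (intro sw.cone2_region) (auto simp: algebra_simps)
    then show ?thesis by (rule slab_swap)
  qed
qed

theorem proposition6:
  fixes lx ly lz uz :: real
  assumes "0 < lz" and "lz < uz" and "uz < 1"
    and "lz \<le> lx" and "lx \<le> uz"
    and "lz \<le> ly" and "ly \<le> uz"
    and "lx * ly < lz"
    and "lx \<ge> sqrt (lz * uz)" and "ly \<ge> sqrt (lz * uz)"
  shows "convex hull {(x, y, z).
             z = x * y \<and> lx \<le> x \<and> x \<le> 1 \<and> ly \<le> y \<and> y \<le> 1 \<and> lz \<le> z \<and> z \<le> uz} =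
         {(x, y, z).
             z \<ge> x + y - 1 \<and>
             z \<ge> ly * x + lx * y - lx * ly \<and>
             z \<le> x + lx * y - lx \<and>
             z \<le> ly * x + y - ly \<and>
             lz \<le> z \<and> z \<le> uz \<and>
             (y \<ge> (ly\<^sup>2 / lz) * x \<and> y \<le> (lz / lx\<^sup>2) * x \<longrightarrow>
               (z + sqrt (lz * uz))\<^sup>2 \<le> (sqrt lz + sqrt uz)\<^sup>2 * (x * y)) \<and>
             (y \<le> (ly\<^sup>2 / lz) * x \<longrightarrow>
               (let lx' = lz / ly in
                 uz * (z - lx' * ly)\<^sup>2
                   \<le> (uz * (x - lx') + lx' * (z - ly * x)) * (uz * (y - ly) + ly * (z - lx' * y)))) \<and>
             (y \<ge> (lz / lx\<^sup>2) * x \<longrightarrow>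
               (let ly' = lz / lx in
                 uz * (z - lx * ly')\<^sup>2
                   \<le> (uz * (x - lx) + lx * (z - ly' * x)) * (uz * (y - ly') + ly' * (z - lx * y))))}"
proof -
  have "lz * uz \<le> lx\<^sup>2" "lz * uz \<le> ly\<^sup>2" using assms by (auto dest: sqrt_le_D)
  then have A: "region_A lx ly lz uz" using assms by unfold_locales auto
  have pos: "0 < lx" "0 < ly" using assms by auto
  \<comment> \<open>The identity lx' * ly = lz turns the stated factors into offsets from the apex
    scaled by uz - lz; lx * ly' = lz does the same for the third constraint.\<close>
  have e2: "z - lz / ly * ly = z - lz"
    "uz * (x - lz / ly) + lz / ly * (z - ly * x) = (uz - lz) * x - lz / ly * (uz - z)"
    "uz * (y - ly) + ly * (z - lz / ly * y) = (uz - lz) * y - ly * (uz - z)" for x y z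
    using pos by (auto simp: field_simps)
  have e3: "z - lx * (lz / lx) = z - lz"
    "uz * (x - lx) + lx * (z - lz / lx * x) = (uz - lz) * x - lx * (uz - z)"
    "uz * (y - lz / lx) + lz / lx * (z - lx * y) = (uz - lz) * y - lz / lx * (uz - z)" for x y z
    using pos by (auto simp: field_simps)
  show ?thesis
    unfolding slab_def[symmetric] Let_def e2 e3
    by (rule set_eqI) (clarsimp simp only: convex_hull_slab_iff[OF A] mem_Collect_eq split_paired_all case_prod_conv)
qed

end
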